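(* Let $E$ be an infinite dimensional real Banach lattice. Then there exists a norm unbounded convex $uo$-pre-Komlós set $C\subseteq E_+$ which is not a $uo$-Komlós set.
   Context: Let $E$ be a real Banach lattice. A sequence $x_n$ in $E$ converges in order to $x\in E$ ($x_n\xrightarrow{o}x$) if there is a sequence $y_n\downarrow 0$ (decreasing with infimum $0$ in $E$) with $|x_n-x|\le y_n$ for all $n$. A sequence $x_n$ is $uo$-convergent (unbounded order convergent) to $x$ if $|x_n-x|\wedge u\xrightarrow{o}0$ for every $u\in E_+$. A sequence $(x_n)$ is $uo$-Cauchy if the double-indexed net $(x_n-x_m)_{(n,m)}$ is unbounded order convergent to $0$, i.e. for every $u\in E_+$ there is a net $(y_\gamma)$ in $E$ with $y_\gamma\downarrow 0$ such that for every $\gamma$ there is $n_0$ with $|x_n-x_m|\wedge u\le y_\gamma$ for all $n,m\ge n_0$. A set $C\subseteq E$ is a $uo$-Komlós set if for every sequence $(x_n)$ in $C$ there exist a subsequence $(x_{n_k})$ and $x\in E$ such that, for every further subsequence $(x_{n_{k_j}})$, the Cesàro means $g_m=\frac1m\sum_{j=1}^m x_{n_{k_j}}$ are $uo$-convergent to $x$. A set $C\subseteq E$ is a $uo$-pre-Komlós set if for every sequence $(x_n)$ in $C$ there exists a subsequence $(x_{n_k})$ such that, for every further subsequence $(x_{n_{k_j}})$, the sequence $g_m=\frac1m\sum_{j=1}^m x_{n_{k_j}}$ is $uo$-Cauchy. *)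

theory Defs
  imports "HOL-Analysis.Analysis" "HOL-Library.Lattice_Algebras" "HOL-Library.Lub_Glb"
begin

class banach_lattice = banach + ordered_real_vector + lattice_ab_group_add_abs +
  assumes norm_abs_mono: "\<bar>x\<bar> \<le> \<bar>y\<bar> \<Longrightarrow> norm x \<le> norm y"

instance real :: banach_lattice
  by standard auto

definition seq_decreasing_to_zero :: "(nat \<Rightarrow> 'a::banach_lattice) \<Rightarrow> bool" where
  "seq_decreasing_to_zero y \<longleftrightarrow> decseq y \<and> isGlb UNIV (range y) 0"

definition order_convergent_to :: "(nat \<Rightarrow> 'a::banach_lattice) \<Rightarrow> 'a \<Rightarrow> bool" where
  "order_convergent_to x l \<longleftrightarrow>
     (\<exists>y. seq_decreasing_to_zero y \<and> (\<forall>n. \<bar>x n - l\<bar> \<le> y n))"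

definition uo_convergent_to :: "(nat \<Rightarrow> 'a::banach_lattice) \<Rightarrow> 'a \<Rightarrow> bool" where
  "uo_convergent_to x l \<longleftrightarrow>
     (\<forall>u\<ge>0. order_convergent_to (\<lambda>n. inf \<bar>x n - l\<bar> u) 0)"

(* (\<alpha>, \<beta>) \<in> r is read as: \<beta> is at least as late as \<alpha> *)
definition directed_index :: "'i set \<Rightarrow> 'i rel \<Rightarrow> bool" where
  "directed_index \<Gamma> r \<longleftrightarrow> \<Gamma> \<noteq> {} \<and> preorder_on \<Gamma> r \<and>
     (\<forall>\<alpha>\<in>\<Gamma>. \<forall>\<beta>\<in>\<Gamma>. \<exists>\<gamma>\<in>\<Gamma>. (\<alpha>, \<gamma>) \<in> r \<and> (\<beta>, \<gamma>) \<in> r)"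

definition net_decreasing_to_zero ::
    "'i set \<Rightarrow> 'i rel \<Rightarrow> ('i \<Rightarrow> 'a::banach_lattice) \<Rightarrow> bool" where
  "net_decreasing_to_zero \<Gamma> r y \<longleftrightarrow> directed_index \<Gamma> r \<and>
     (\<forall>\<alpha>\<in>\<Gamma>. \<forall>\<beta>\<in>\<Gamma>. (\<alpha>, \<beta>) \<in> r \<longrightarrow> y \<beta> \<le> y \<alpha>) \<and> isGlb UNIV (y ` \<Gamma>) 0"

(* The index set of the dominating net is a directed set of elements of the space itself:
   HOL cannot quantify over index types inside a formula, and uo_cauchyI below shows that
   a net over any other index type yields one of this kind. *)
definition uo_cauchy :: "(nat \<Rightarrow> 'a::banach_lattice) \<Rightarrow> bool" where
  "uo_cauchy x \<longleftrightarrow>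
     (\<forall>u\<ge>0. \<exists>(\<Gamma>::'a set) r (y::'a \<Rightarrow> 'a). net_decreasing_to_zero \<Gamma> r y \<and>
        (\<forall>\<gamma>\<in>\<Gamma>. \<exists>n0. \<forall>n\<ge>n0. \<forall>m\<ge>n0. inf \<bar>x n - x m\<bar> u \<le> y \<gamma>))"

lemma uo_cauchyI:
  fixes x :: "nat \<Rightarrow> 'a::banach_lattice"
  assumes "\<And>u. 0 \<le> u \<Longrightarrow> \<exists>(\<Gamma>::'i set) r (y::'i \<Rightarrow> 'a). net_decreasing_to_zero \<Gamma> r y \<and>
        (\<forall>\<gamma>\<in>\<Gamma>. \<exists>n0. \<forall>n\<ge>n0. \<forall>m\<ge>n0. inf \<bar>x n - x m\<bar> u \<le> y \<gamma>)"
  shows "uo_cauchy x"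
  unfolding uo_cauchy_def
proof (intro allI impI)
  fix u :: 'a assume "0 \<le> u"
  then obtain \<Gamma> :: "'i set" and r and y :: "'i \<Rightarrow> 'a"
    where net: "net_decreasing_to_zero \<Gamma> r y"
      and dom: "\<forall>\<gamma>\<in>\<Gamma>. \<exists>n0. \<forall>n\<ge>n0. \<forall>m\<ge>n0. inf \<bar>x n - x m\<bar> u \<le> y \<gamma>"
    using assms by blast
  let ?D = "y ` \<Gamma>"
  let ?r = "{(a, b). a \<in> ?D \<and> b \<in> ?D \<and> b \<le> a}"
  have "preorder_on ?D ?r"
    by (auto simp: preorder_on_def refl_on_def trans_def)
  moreover have "\<exists>c\<in>?D. (a, c) \<in> ?r \<and> (b, c) \<in> ?r" if ab: "a \<in> ?D" "b \<in> ?D" for a b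
  proof -
    from ab obtain \<alpha> \<beta> where "\<alpha> \<in> \<Gamma>" "\<beta> \<in> \<Gamma>" "a = y \<alpha>" "b = y \<beta>"
      by blast
    moreover obtain \<gamma> where "\<gamma> \<in> \<Gamma>" "(\<alpha>, \<gamma>) \<in> r" "(\<beta>, \<gamma>) \<in> r"
      using net \<open>\<alpha> \<in> \<Gamma>\<close> \<open>\<beta> \<in> \<Gamma>\<close>
      unfolding net_decreasing_to_zero_def directed_index_def by blast
    ultimately show ?thesis
      using net unfolding net_decreasing_to_zero_def by auto
  qed
  ultimately have "net_decreasing_to_zero ?D ?r (\<lambda>a. a)"
    using net unfolding net_decreasing_to_zero_def directed_index_def
    by (simp add: image_image)
  with dom show "\<exists>(\<Gamma>::'a set) r (y::'a \<Rightarrow> 'a). net_decreasing_to_zero \<Gamma> r y \<and>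
      (\<forall>\<gamma>\<in>\<Gamma>. \<exists>n0. \<forall>n\<ge>n0. \<forall>m\<ge>n0. inf \<bar>x n - x m\<bar> u \<le> y \<gamma>)"
    by (intro exI[of _ ?D] exI[of _ ?r] exI[of _ "\<lambda>a. a"]) blast
qed

(* Sequences are indexed from 0, so cesaro x m is the mean of the first m + 1 terms. *)
definition cesaro :: "(nat \<Rightarrow> 'a::real_vector) \<Rightarrow> nat \<Rightarrow> 'a" where
  "cesaro x m = (1 / real (Suc m)) *\<^sub>R (\<Sum>j\<le>m. x j)"

definition uo_komlos_set :: "'a::banach_lattice set \<Rightarrow> bool" where
  "uo_komlos_set C \<longleftrightarrow>
     (\<forall>x. range x \<subseteq> C \<longrightarrow>
        (\<exists>k :: nat \<Rightarrow> nat. \<exists>l. strict_mono k \<and>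
           (\<forall>s :: nat \<Rightarrow> nat. strict_mono s \<longrightarrow> uo_convergent_to (cesaro (x \<circ> k \<circ> s)) l)))"

definition uo_pre_komlos_set :: "'a::banach_lattice set \<Rightarrow> bool" where
  "uo_pre_komlos_set C \<longleftrightarrow>
     (\<forall>x. range x \<subseteq> C \<longrightarrow>
        (\<exists>k :: nat \<Rightarrow> nat. strict_mono k \<and>
           (\<forall>s :: nat \<Rightarrow> nat. strict_mono s \<longrightarrow> uo_cauchy (cesaro (x \<circ> k \<circ> s)))))"

end

theory Submission
  imports Defs
begin

text \<open>
An infinite dimensional Banach lattice contains pairwise disjoint positive vectors $e_k$, which we
scale so that $e_k$ has norm $k$. Let $C$ be the set of finite sums of the $c_k e_k$ with
$0 \le c_k \le 1$. Passing to a diagonal subsequence makes all coordinates of a sequence in $C$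
converge, hence also those of the Cesaro means of all further subsequences; for disjoint $e_k$ this
coordinatewise convergence already forces the means to be uo-Cauchy. On the other hand, a uo-limit
of Cesaro means of a subsequence of $e_0 + \dots + e_{n-1}$ would dominate $e_i / 2$ for every $i$
and so have infinite norm.
\<close>

section \<open>Archimedean property and disjointness in a Banach lattice\<close>

text \<open>Completeness plays no part here: monotonicity of the norm bounds the norm of the
  positive part of \<open>x\<close> by arbitrarily small multiples of \<open>norm u\<close>, so that
  part is zero.\<close>

lemma archimedean_le_zero:
  fixes x u :: "'a::banach_lattice"
  assumes "\<And>\<epsilon>. \<epsilon> > 0 \<Longrightarrow> x \<le> \<epsilon> *\<^sub>R u"
  shows "x \<le> 0"
proof -
  define p where "p = sup x 0"
  have p0: "0 \<le> p" by (simp add: p_def)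
  have np: "norm p \<le> \<epsilon> * norm u" if "\<epsilon> > 0" for \<epsilon>
  proof -
    have ge: "0 \<le> \<epsilon> *\<^sub>R \<bar>u\<bar>" using that by (simp add: scaleR_nonneg_nonneg)
    have "x \<le> \<epsilon> *\<^sub>R \<bar>u\<bar>"
      using assms[OF that] that scaleR_left_mono[OF abs_ge_self[of u], of \<epsilon>] by auto
    with ge have "p \<le> \<epsilon> *\<^sub>R \<bar>u\<bar>" by (simp add: p_def)
    with p0 ge have "norm p \<le> norm (\<epsilon> *\<^sub>R \<bar>u\<bar>)"
      by (intro norm_abs_mono) simp
    also have "norm \<bar>u\<bar> = norm u"
      by (intro antisym norm_abs_mono) simp_all
    then have "norm (\<epsilon> *\<^sub>R \<bar>u\<bar>) = \<epsilon> * norm u" using that by simp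
    finally show ?thesis .
  qed
  have "norm p \<le> 0"
  proof (rule field_le_epsilon)
    fix e :: real assume "e > 0"
    \<comment> \<open>The added \<open>1\<close> keeps the divisor positive when \<open>u\<close> is
      zero.\<close>
    have pos: "0 < norm u + 1"
      by (simp add: add_nonneg_pos)
    have "norm p \<le> e / (norm u + 1) * norm u" using pos \<open>e > 0\<close> by (intro np) simp
    also have "\<dots> \<le> 0 + e" using pos \<open>e > 0\<close> by (simp add: field_simps)
    finally show "norm p \<le> 0 + e" .
  qed
  then have "p = 0" by simp
  then show ?thesis by (metis p_def sup.cobounded1)
qed

lemma archimedean_multiples:
  fixes x u :: "'a::banach_lattice"
  assumes "\<And>n::nat. real n *\<^sub>R x \<le> u" and "0 \<le> u"
  shows "x \<le> 0"
proof (rule archimedean_le_zero[of _ u])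
  fix \<epsilon> :: real assume "\<epsilon> > 0"
  then obtain n :: nat where n: "inverse (real (Suc n)) < \<epsilon>" using reals_Archimedean by blast
  have "x = inverse (real (Suc n)) *\<^sub>R (real (Suc n) *\<^sub>R x)" by simp
  also have "\<dots> \<le> inverse (real (Suc n)) *\<^sub>R u"
    by (intro scaleR_left_mono assms) simp
  also have "\<dots> \<le> \<epsilon> *\<^sub>R u" using n assms(2) by (intro scaleR_right_mono) auto
  finally show "x \<le> \<epsilon> *\<^sub>R u" .
qed

text \<open>Both \<open>x + inf y z\<close> and \<open>z + inf y z\<close> are upper bounds of the
  left side, and their infimum is the right side.\<close>

lemma inf_add_le:
  fixes x y z :: "'a::banach_lattice"
  assumes "0 \<le> x" "0 \<le> y" "0 \<le> z"
  shows "inf (x + y) z \<le> inf x z + inf y z"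
proof -
  have "inf (x + y) z \<le> inf (x + y) (x + z)"
    using assms by (intro inf_mono) simp_all
  also have "\<dots> = x + inf y z" by (simp add: add_inf_distrib_left)
  finally have "inf (x + y) z \<le> x + inf y z" .
  moreover have "inf (x + y) z \<le> z + inf y z"
    using assms by (intro le_infI2) simp
  ultimately show ?thesis by (simp add: add_inf_distrib_right)
qed

lemma disjoint_add_le:
  fixes x y u :: "'a::banach_lattice"
  assumes "inf x y = 0" "x \<le> u" "y \<le> u"
  shows "x + y \<le> u"
proof -
  have "x + y = sup x y" using add_eq_inf_sup[of x y] unfolding assms(1) by (simp only: add_0_right)
  with assms show ?thesis by simp
qed

lemma disjoint_mono:
  fixes x y z :: "'a::banach_lattice"
  assumes "inf x y = 0" "0 \<le> z" "z \<le> y"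
  shows "inf x z = 0"
proof (rule antisym)
  show "inf x z \<le> 0" using assms by (metis inf_mono order_refl)
  have "0 \<le> x" using assms(1) by (metis inf_le1)
  then show "0 \<le> inf x z" using assms by simp
qed

lemma disjoint_add:
  fixes x y z :: "'a::banach_lattice"
  assumes "inf z x = 0" "inf z y = 0"
  shows "inf z (x + y) = 0"
proof (rule antisym)
  have nn: "0 \<le> x" "0 \<le> y" "0 \<le> z" using assms by (metis inf_le1 inf_le2)+
  from inf_add_le[OF nn] assms show "inf z (x + y) \<le> 0" by (simp add: inf_commute)
  show "0 \<le> inf z (x + y)" using nn by simp
qed

lemma disjoint_scaleR:
  fixes x z :: "'a::banach_lattice"
  assumes "inf z x = 0" "0 \<le> c"
  shows "inf z (c *\<^sub>R x) = 0"
proof (rule antisym)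
  have nn: "0 \<le> x" "0 \<le> z" using assms by (metis inf_le1 inf_le2)+
  define w where "w = inf z (c *\<^sub>R x)"
  \<comment> \<open>Dividing by \<open>d\<close> brings \<open>w\<close> below \<open>x\<close>
    because \<open>c \<le> d\<close>, and keeps it below \<open>z\<close> because
    \<open>1 \<le> d\<close>.\<close>
  define d where "d = max 1 c"
  have d: "1 \<le> d" "c \<le> d" "0 < d" by (auto simp: d_def)
  have "0 \<le> w" using nn assms(2) by (simp add: w_def scaleR_nonneg_nonneg)
  have "inverse d *\<^sub>R w \<le> w"
    using scaleR_right_mono[OF _ \<open>0 \<le> w\<close>, of "inverse d" 1] d by (simp add: inverse_le_1_iff)
  also have "w \<le> z" by (simp add: w_def)
  finally have 1: "inverse d *\<^sub>R w \<le> z" .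
  have "w \<le> c *\<^sub>R x" by (simp add: w_def)
  also have "\<dots> \<le> d *\<^sub>R x" using d nn by (intro scaleR_right_mono)
  finally have 2: "inverse d *\<^sub>R w \<le> x" using d by (simp add: pos_divideR_le_eq)
  from 1 2 have "inverse d *\<^sub>R w \<le> 0" using assms(1) by (metis le_inf_iff)
  then show "w \<le> 0" using d by (simp add: pos_divideR_le_eq)
  show "0 \<le> w" by fact
qed

lemma disjoint_sum:
  fixes x :: "'b \<Rightarrow> 'a::banach_lattice"
  assumes "\<And>i. i \<in> A \<Longrightarrow> inf z (x i) = 0" "0 \<le> z"
  shows "inf z (\<Sum>i\<in>A. x i) = 0"
  using assms(1)
proof (induction A rule: infinite_finite_induct)
  case (insert i A)
  then have "inf z (x i + (\<Sum>i\<in>A. x i)) = 0" by (intro disjoint_add) auto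
  with insert.hyps show ?case by simp
qed (use assms(2) in \<open>simp_all add: inf_absorb2\<close>)

section \<open>A criterion for uo-Cauchy sequences\<close>

text \<open>Treats one direction at a time: \<open>small\<close> controls the differences along each
  \<open>e\<close> up to an error \<open>h\<close> of any size off \<open>e\<close>, with
  \<open>n0\<close> depending on \<open>e\<close>, and \<open>carried\<close> excludes a part
  disjoint from all of \<open>S\<close>.\<close>

lemma uo_cauchy_criterion:
  fixes x :: "nat \<Rightarrow> 'a::banach_lattice"
  assumes small: "\<And>e \<epsilon>. e \<in> S \<Longrightarrow> \<epsilon> > 0 \<Longrightarrow> \<exists>n0. \<forall>n\<ge>n0. \<forall>m\<ge>n0.
      \<exists>h. inf e h = 0 \<and> \<bar>x n - x m\<bar> \<le> \<epsilon> *\<^sub>R e + h"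
    and carried: "\<And>z n m. 0 \<le> z \<Longrightarrow> (\<And>e. e \<in> S \<Longrightarrow> inf z e = 0) \<Longrightarrow> inf z \<bar>x n - x m\<bar> = 0"
    and S: "\<And>e. e \<in> S \<Longrightarrow> 0 \<le> e"
  shows "uo_cauchy x"
  unfolding uo_cauchy_def
proof (intro allI impI)
  fix u :: 'a assume u: "0 \<le> u"
  \<comment> \<open>No supremum of a tail needs to exist in the space, so the dominating net consists of all
    eventual upper bounds; the point is that their infimum is \<open>0\<close>.\<close>
  define D where "D = {y. \<exists>n0. \<forall>n\<ge>n0. \<forall>m\<ge>n0. inf \<bar>x n - x m\<bar> u \<le> y}"
  define r where "r = {(a, b). a \<in> D \<and> b \<in> D \<and> b \<le> a}"
  have "u \<in> D" by (auto simp: D_def)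
  have inf_D: "inf a b \<in> D" if "a \<in> D" "b \<in> D" for a b
  proof -
    from that obtain n1 n2 where
      "\<forall>n\<ge>n1. \<forall>m\<ge>n1. inf \<bar>x n - x m\<bar> u \<le> a" "\<forall>n\<ge>n2. \<forall>m\<ge>n2. inf \<bar>x n - x m\<bar> u \<le> b"
      unfolding D_def by blast
    then have "\<forall>n\<ge>max n1 n2. \<forall>m\<ge>max n1 n2. inf \<bar>x n - x m\<bar> u \<le> inf a b" by simp
    then show ?thesis unfolding D_def by blast
  qed
  have dir: "directed_index D r"
    unfolding directed_index_def
  proof (intro conjI ballI)
    show "D \<noteq> {}" using \<open>u \<in> D\<close> by blast
    show "preorder_on D r" by (auto simp: preorder_on_def refl_on_def trans_def r_def)
    show "\<exists>\<gamma>\<in>D. (\<alpha>, \<gamma>) \<in> r \<and> (\<beta>, \<gamma>) \<in> r" if "\<alpha> \<in> D" "\<beta> \<in> D" for \<alpha> \<beta>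
      using that inf_D[OF that] by (intro bexI[of _ "inf \<alpha> \<beta>"]) (auto simp: r_def)
  qed
  have D_nonneg: "0 \<le> y" if "y \<in> D" for y
  proof -
    from that obtain n0 where "inf \<bar>x n0 - x n0\<bar> u \<le> y" unfolding D_def by blast
    with u show ?thesis by (simp add: inf_absorb1)
  qed
  have lower: "z \<le> 0" if z: "0 \<le> z" and lb: "\<And>y. y \<in> D \<Longrightarrow> z \<le> y" for z
  proof -
    \<comment> \<open>In the limit the truncated differences live off \<open>e\<close>, so a lower bound \<open>z\<close> of \<open>D\<close> sits below
      \<open>(u - t e)\<^sup>+ = u - inf u (t e)\<close> for all \<open>t\<close>. Hence \<open>p = inf z e\<close> has all its multiples below \<open>u\<close>
      and vanishes. Once \<open>z\<close> is disjoint from \<open>S\<close>, the vectors \<open>u - n z\<close> lie in \<open>D\<close> for all \<open>n\<close>.\<close>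
    have below: "z \<le> u - inf u (t *\<^sub>R e)" if e: "e \<in> S" and t: "0 \<le> t" for e t
    proof -
      have te: "0 \<le> t *\<^sub>R e" using S[OF e] t by (simp add: scaleR_nonneg_nonneg)
      have "z - (u - inf u (t *\<^sub>R e)) \<le> \<epsilon> *\<^sub>R e" if eps: "\<epsilon> > 0" for \<epsilon>
      proof -
        have ee: "0 \<le> \<epsilon> *\<^sub>R e" using S[OF e] eps by (simp add: scaleR_nonneg_nonneg)
        obtain n0 where n0: "\<And>n m. n \<ge> n0 \<Longrightarrow> m \<ge> n0 \<Longrightarrow>
            \<exists>h. inf e h = 0 \<and> \<bar>x n - x m\<bar> \<le> \<epsilon> *\<^sub>R e + h"
          using small[OF e eps] by blast
        \<comment> \<open>Since \<open>h\<close> is disjoint from \<open>e\<close>, the vectors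
          \<open>inf h u\<close> and \<open>inf u (t *\<^sub>R e)\<close> are disjoint. Both lie
          below \<open>u\<close>, hence so does their sum.\<close>
        have "\<epsilon> *\<^sub>R e + (u - inf u (t *\<^sub>R e)) \<in> D"
          unfolding D_def
        proof (intro CollectI exI[of _ n0] allI impI)
          fix n m assume "n0 \<le> n" "n0 \<le> m"
          then obtain h where h: "inf e h = 0" "\<bar>x n - x m\<bar> \<le> \<epsilon> *\<^sub>R e + h"
            using n0 by blast
          have "0 \<le> h" using h(1) by (metis inf_le2)
          have "inf h (t *\<^sub>R e) = 0" using h(1) t by (intro disjoint_scaleR) (simp_all add: inf_commute)
          moreover have "inf (inf h u) (inf u (t *\<^sub>R e)) \<le> inf h (t *\<^sub>R e)"
            by (intro inf_mono) simp_all
          moreover have "0 \<le> inf (inf h u) (inf u (t *\<^sub>R e))" using \<open>0 \<le> h\<close> u te by simp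
          ultimately have "inf (inf h u) (inf u (t *\<^sub>R e)) = 0" by (metis antisym)
          then have "inf h u + inf u (t *\<^sub>R e) \<le> u" by (rule disjoint_add_le) simp_all
          then have hu: "inf h u \<le> u - inf u (t *\<^sub>R e)" by (simp only: le_diff_eq)
          have "inf \<bar>x n - x m\<bar> u \<le> inf (\<epsilon> *\<^sub>R e + h) u" using h(2) by (rule inf_mono) simp
          also have "\<dots> \<le> inf (\<epsilon> *\<^sub>R e) u + inf h u" by (rule inf_add_le[OF ee \<open>0 \<le> h\<close> u])
          also have "\<dots> \<le> \<epsilon> *\<^sub>R e + (u - inf u (t *\<^sub>R e))" by (intro add_mono hu) simp
          finally show "inf \<bar>x n - x m\<bar> u \<le> \<epsilon> *\<^sub>R e + (u - inf u (t *\<^sub>R e))" .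
        qed
        from lb[OF this] show ?thesis by (simp add: algebra_simps)
      qed
      then have "z - (u - inf u (t *\<^sub>R e)) \<le> 0" by (rule archimedean_le_zero)
      then show ?thesis by simp
    qed
    have orth: "inf z e = 0" if e: "e \<in> S" for e
    proof (rule antisym)
      define p where "p = inf z e"
      have p: "0 \<le> p" "p \<le> z" "p \<le> e" using z S[OF e] by (auto simp: p_def)
      \<comment> \<open>The bound for \<open>n\<close> gives
        \<open>real n *\<^sub>R p \<le> inf u (real n *\<^sub>R e)\<close>, while
        \<open>below\<close> with \<open>t = real n\<close> leaves room for one more
        \<open>p\<close>.\<close>
      have "real n *\<^sub>R p \<le> u" for n
      proof (induction n)
        case (Suc n)
        have "real n *\<^sub>R p \<le> real n *\<^sub>R e" using p by (intro scaleR_left_mono) simp_all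
        with Suc have "real n *\<^sub>R p \<le> inf u (real n *\<^sub>R e)" by simp
        moreover have "p \<le> u - inf u (real n *\<^sub>R e)" using below[OF e, of "real n"] p by simp
        ultimately have "p + real n *\<^sub>R p \<le> u"
          by (metis add_mono diff_add_cancel)
        then show ?case by (simp add: algebra_simps)
      qed (simp add: u)
      then have "p \<le> 0" using u by (rule archimedean_multiples)
      then show "inf z e \<le> 0" by (simp add: p_def)
      show "0 \<le> inf z e" using p by (simp add: p_def)
    qed
    have "real n *\<^sub>R z \<le> u" for n
    proof (induction n)
      case (Suc n)
      \<comment> \<open>The multiple of \<open>z\<close> and the truncated difference are disjoint
        and both lie below \<open>u\<close>, so their sum does too. As \<open>z\<close> is a lower
        bound of \<open>D\<close>, one more copy of \<open>z\<close> fits below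
        \<open>u\<close>.\<close>
      have "u - real n *\<^sub>R z \<in> D"
        unfolding D_def
      proof (intro CollectI exI[of _ 0] allI impI)
        fix k m :: nat
        have "inf \<bar>x k - x m\<bar> z = 0"
          using carried[OF z orth, of k m] by (simp only: inf_commute)
        then have "inf \<bar>x k - x m\<bar> (real n *\<^sub>R z) = 0"
          by (rule disjoint_scaleR) simp
        then have "inf (real n *\<^sub>R z) \<bar>x k - x m\<bar> = 0"
          by (simp only: inf_commute)
        then have "inf (real n *\<^sub>R z) (inf \<bar>x k - x m\<bar> u) = 0"
          by (rule disjoint_mono) (use u in simp_all)
        then have "real n *\<^sub>R z + inf \<bar>x k - x m\<bar> u \<le> u"
          using Suc by (intro disjoint_add_le) simp_all
        then show "inf \<bar>x k - x m\<bar> u \<le> u - real n *\<^sub>R z" by (simp add: algebra_simps)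
      qed
      from lb[OF this] show ?case by (simp add: algebra_simps)
    qed (simp add: u)
    then show ?thesis using u by (rule archimedean_multiples)
  qed
  have "isGlb UNIV ((\<lambda>y. y) ` D) 0"
    unfolding isGlb_def greatestP_def isLb_def setge_def setle_def
  proof (intro conjI ballI CollectI UNIV_I)
    show "0 \<le> y" if "y \<in> (\<lambda>y. y) ` D" for y using that D_nonneg by auto
    fix z assume "z \<in> {z. Ball ((\<lambda>y. y) ` D) ((\<le>) z) \<and> z \<in> UNIV}"
    \<comment> \<open>The claim \<open>lower\<close> covers only nonnegative lower bounds;
      \<open>sup z 0\<close> is one because \<open>D\<close> is nonnegative.\<close>
    then have "sup z 0 \<le> 0" using D_nonneg by (intro lower) auto
    then show "z \<le> 0" by simp
  qed
  with dir have "net_decreasing_to_zero D r (\<lambda>y. y)"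
    by (auto simp: net_decreasing_to_zero_def r_def)
  then show "\<exists>(\<Gamma>::'a set) r (y::'a \<Rightarrow> 'a). net_decreasing_to_zero \<Gamma> r y \<and>
      (\<forall>\<gamma>\<in>\<Gamma>. \<exists>n0. \<forall>n\<ge>n0. \<forall>m\<ge>n0. inf \<bar>x n - x m\<bar> u \<le> y \<gamma>)"
    by (intro exI[of _ D] exI[of _ r] exI[of _ "\<lambda>y. y"]) (auto simp: D_def)
qed

section \<open>Atoms and the construction of a disjoint sequence\<close>

text \<open>Indecomposability is used rather than the requirement that the interval below
  \<open>a\<close> consist of multiples of \<open>a\<close>: its failure directly supplies two
  nonzero disjoint pieces.\<close>

definition atom :: "'a::banach_lattice \<Rightarrow> bool" where
  "atom a \<longleftrightarrow> 0 \<le> a \<and> a \<noteq> 0 \<and>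
     (\<forall>x y. 0 \<le> x \<longrightarrow> x \<le> a \<longrightarrow> 0 \<le> y \<longrightarrow> y \<le> a \<longrightarrow> inf x y = 0 \<longrightarrow> x = 0 \<or> y = 0)"

text \<open>The coefficient is the largest \<open>t\<close> with
  \<open>t *\<^sub>R a \<le> x\<close>. An overlap of the remainder with \<open>a\<close> that is
  not infinitesimal would let a larger multiple fit.\<close>

lemma atom_component:
  fixes a x :: "'a::banach_lattice"
  assumes a: "atom a" and x: "0 \<le> x"
  obtains t where "0 \<le> t" "t *\<^sub>R a \<le> x" "inf (x - t *\<^sub>R a) a = 0"
proof -
  have a0: "0 \<le> a" "a \<noteq> 0" using a by (auto simp: atom_def)
  define T where "T = {t. 0 \<le> t \<and> t *\<^sub>R a \<le> x}"
  have "0 \<in> T" using x by (simp add: T_def)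
  have bdd: "bdd_above T"
  proof (rule ccontr)
    assume nb: "\<not> bdd_above T"
    have "real n *\<^sub>R a \<le> x" for n
    proof -
      from nb obtain t where t: "t \<in> T" "real n < t"
        by (metis bdd_above.I not_less)
      then have "real n *\<^sub>R a \<le> t *\<^sub>R a" using a0 by (intro scaleR_right_mono) auto
      with t show ?thesis by (auto simp: T_def)
    qed
    then have "a \<le> 0" using x by (rule archimedean_multiples)
    with a0 show False by auto
  qed
  define t where "t = Sup T"
  have "0 \<le> t" using \<open>0 \<in> T\<close> bdd by (simp add: t_def cSup_upper)
  have tax: "t *\<^sub>R a \<le> x"
  proof -
    have "t *\<^sub>R a - x \<le> \<epsilon> *\<^sub>R a" if "\<epsilon> > 0" for \<epsilon>
    proof -
      have "t - \<epsilon> < Sup T" using that by (simp add: t_def)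
      then obtain s where s: "s \<in> T" "t - \<epsilon> < s" using \<open>0 \<in> T\<close> bdd less_cSup_iff by blast
      then have "(t - \<epsilon>) *\<^sub>R a \<le> s *\<^sub>R a" using a0 by (intro scaleR_right_mono) auto
      also have "\<dots> \<le> x" using s by (simp add: T_def)
      finally show ?thesis by (simp add: algebra_simps)
    qed
    then have "t *\<^sub>R a - x \<le> 0" by (rule archimedean_le_zero)
    then show ?thesis by simp
  qed
  define r where "r = x - t *\<^sub>R a"
  have r0: "0 \<le> r" using tax by (simp add: r_def)
  define p where "p = inf r a"
  have p: "0 \<le> p" "p \<le> r" "p \<le> a" using r0 a0 by (auto simp: p_def)
  have "p \<le> \<epsilon> *\<^sub>R a" if e: "\<epsilon> > 0" for \<epsilon>
  proof -
    have ea: "0 \<le> \<epsilon> *\<^sub>R a" using a0 e by (simp add: scaleR_nonneg_nonneg)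
    \<comment> \<open>\<open>f\<close> and \<open>g\<close> are the positive and negative parts of
      \<open>r - \<epsilon> *\<^sub>R a\<close>, hence disjoint. Truncated by \<open>a\<close>, one
      of them must vanish because \<open>a\<close> is an atom.\<close>
    define f where "f = sup (r - \<epsilon> *\<^sub>R a) 0"
    define g where "g = sup (\<epsilon> *\<^sub>R a - r) 0"
    have fg: "inf f g = 0"
    proof -
      have "f = sup r (\<epsilon> *\<^sub>R a) - \<epsilon> *\<^sub>R a" "g = sup r (\<epsilon> *\<^sub>R a) - r"
        unfolding f_def g_def diff_conv_add_uminus add_sup_distrib_right
        by (simp_all add: sup_commute)
      then have "inf f g = sup r (\<epsilon> *\<^sub>R a) + inf (- (\<epsilon> *\<^sub>R a)) (- r)"
        by (simp add: add_inf_distrib_left)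
      also have "\<dots> = 0" by (simp add: inf_commute flip: neg_sup_eq_inf)
      finally show ?thesis .
    qed
    have nn: "0 \<le> f" "0 \<le> g" by (simp_all add: f_def g_def)
    have "inf (inf f a) (inf g a) = 0"
      using fg nn a0 by (metis disjoint_mono inf_commute inf_le1 le_inf_iff)
    then have "inf f a = 0 \<or> inf g a = 0" using a nn a0 by (simp add: atom_def)
    \<comment> \<open>Here \<open>g\<close> lies below \<open>\<epsilon> *\<^sub>R a\<close>, so
      disjointness from \<open>a\<close> makes it zero. Then \<open>\<epsilon> *\<^sub>R a\<close>
      fits into the remainder, against the maximality of \<open>t\<close>.\<close>
    moreover have False if ga: "inf g a = 0"
    proof -
      have "inf g (\<epsilon> *\<^sub>R a) = 0" using ga e by (intro disjoint_scaleR) auto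
      moreover have "g \<le> \<epsilon> *\<^sub>R a" using ea r0 by (simp add: g_def)
      ultimately have "g = 0" by (simp add: inf_absorb1)
      then have "\<epsilon> *\<^sub>R a \<le> r" unfolding g_def by (metis diff_le_0_iff_le sup.cobounded1)
      then have "(t + \<epsilon>) *\<^sub>R a \<le> x" by (simp add: r_def algebra_simps)
      then have "t + \<epsilon> \<in> T" using \<open>0 \<le> t\<close> e by (simp add: T_def)
      then have "t + \<epsilon> \<le> t" unfolding t_def using bdd by (rule cSup_upper)
      with e show False by simp
    qed
    ultimately have fa: "inf f a = 0" by blast
    \<comment> \<open>The positive part of \<open>p - \<epsilon> *\<^sub>R a\<close> lies below both
      \<open>f\<close> and \<open>a\<close>, which are disjoint.\<close>
    have "sup (p - \<epsilon> *\<^sub>R a) 0 \<le> f" unfolding f_def using p by (intro sup_mono) auto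
    moreover have "sup (p - \<epsilon> *\<^sub>R a) 0 \<le> a"
      using p ea a0 by (metis add.right_neutral diff_le_eq add_mono sup.boundedI)
    ultimately have "sup (p - \<epsilon> *\<^sub>R a) 0 \<le> 0" using fa by (metis le_inf_iff)
    then show ?thesis by simp
  qed
  then have "p \<le> 0" by (rule archimedean_le_zero)
  with p(1) have "p = 0" by (rule antisym[rotated])
  then have "inf (x - t *\<^sub>R a) a = 0" by (simp only: p_def r_def)
  with \<open>0 \<le> t\<close> tax that show thesis by blast
qed

text \<open>The atoms are split off one by one; each new remainder is smaller than the last and so
  stays disjoint from the atoms already treated.\<close>

lemma atoms_remainder:
  fixes x :: "'a::banach_lattice"
  assumes "finite A" "\<And>a. a \<in> A \<Longrightarrow> atom a" "0 \<le> x"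
  obtains r where "0 \<le> r" "\<And>a. a \<in> A \<Longrightarrow> inf r a = 0" "x - r \<in> span A"
  using assms
proof (induction A arbitrary: thesis rule: finite_induct)
  case empty
  then show ?case by (simp add: span_zero)
next
  case (insert b A)
  obtain r where r: "0 \<le> r" "\<And>a. a \<in> A \<Longrightarrow> inf r a = 0" "x - r \<in> span A"
    using insert.IH insert.prems by blast
  have b: "atom b" using insert.prems by blast
  then have "0 \<le> b" by (simp add: atom_def)
  obtain t where t: "0 \<le> t" "t *\<^sub>R b \<le> r" "inf (r - t *\<^sub>R b) b = 0"
    using atom_component[OF b r(1)] by blast
  show ?case
  proof (rule insert.prems(1))
    show nn: "0 \<le> r - t *\<^sub>R b" using t by simp
    have le: "r - t *\<^sub>R b \<le> r" using t \<open>0 \<le> b\<close> by (simp add: scaleR_nonneg_nonneg)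
    show "inf (r - t *\<^sub>R b) a = 0" if "a \<in> insert b A" for a
      using that t(3) r(2) nn le by (metis disjoint_mono inf_commute insert_iff)
    have "x - r \<in> span (insert b A)" using r(3) span_mono by blast
    moreover have "t *\<^sub>R b \<in> span (insert b A)" by (simp add: span_base span_scale)
    ultimately have "(x - r) + t *\<^sub>R b \<in> span (insert b A)" by (rule span_add)
    then show "x - (r - t *\<^sub>R b) \<in> span (insert b A)" by (simp add: algebra_simps)
  qed
qed

text \<open>Otherwise every remainder vanishes, so the finite set \<open>A\<close> spans all
  positive vectors and therefore, by taking differences, the whole space.\<close>

lemma exists_disjoint_from_atoms:
  fixes A :: "'a::banach_lattice set"
  assumes inf_dim: "\<not> (\<exists>B :: 'a set. finite B \<and> span B = UNIV)"
    and A: "finite A" "\<And>a. a \<in> A \<Longrightarrow> atom a"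
  obtains x where "0 \<le> x" "x \<noteq> 0" "\<And>a. a \<in> A \<Longrightarrow> inf x a = 0"
proof (rule ccontr)
  note found = that
  assume "\<not> thesis"
  then have max: "x = 0" if "0 \<le> x" "\<And>a. a \<in> A \<Longrightarrow> inf x a = 0" for x
    using that found by blast
  have pos: "x \<in> span A" if "0 \<le> x" for x
    using atoms_remainder[OF A that] max by (metis diff_zero)
  have "x \<in> span A" for x
  proof -
    have "pprt x - (- nprt x) \<in> span A"
      by (intro span_diff pos) simp_all
    then show ?thesis by (simp flip: prts)
  qed
  with inf_dim A(1) show False by blast
qed

lemma disjoint_sequence_below_atomless:
  fixes x :: "'a::banach_lattice"
  assumes x: "0 \<le> x" "x \<noteq> 0" and noatom: "\<And>a. a \<le> x \<Longrightarrow> \<not> atom a"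
  shows "\<exists>e :: nat \<Rightarrow> 'a. \<forall>j. 0 \<le> e j \<and> e j \<noteq> 0 \<and> (\<forall>i<j. inf (e i) (e j) = 0)"
proof -
  let ?P = "\<lambda>z. 0 \<le> z \<and> z \<noteq> 0 \<and> z \<le> x"
  \<comment> \<open>Of the current vector \<open>z\<close>, the piece \<open>y\<close> is set aside
    as a term of the sequence and the disjoint piece \<open>z'\<close> is split further. All later
    terms lie below \<open>z'\<close>.\<close>
  let ?Q = "\<lambda>z y z'. 0 \<le> y \<and> y \<noteq> 0 \<and> y \<le> z \<and> z' \<le> z \<and> inf y z' = 0"
  have "\<exists>f. \<forall>n. ?P (f n) \<and> (\<exists>y. ?Q (f n) y (f (Suc n)))"
  proof (rule dependent_nat_choice)
    show "\<exists>z. ?P z" using x by blast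
    fix z assume z: "?P z"
    then have "\<not> atom z" using noatom by blast
    then obtain y w where "0 \<le> y" "y \<le> z" "0 \<le> w" "w \<le> z" "inf y w = 0" "y \<noteq> 0" "w \<noteq> 0"
      using z unfolding atom_def by blast
    then show "\<exists>z'. ?P z' \<and> (\<exists>y. ?Q z y z')" using z by (intro exI[of _ w]) auto
  qed
  then obtain f e where fe: "\<And>n. ?P (f n)" "\<And>n. ?Q (f n) (e n) (f (Suc n))" by metis
  have "decseq f" using fe(2) by (intro decseq_SucI) blast
  have "inf (e i) (e j) = 0" if "i < j" for i j
  proof -
    have "e j \<le> f j" using fe by blast
    also have "\<dots> \<le> f (Suc i)" using \<open>decseq f\<close> that by (simp add: decseqD)
    finally have "e j \<le> f (Suc i)" .
    moreover have "inf (e i) (f (Suc i)) = 0" "0 \<le> e j" using fe(2) by blast+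
    ultimately show ?thesis by (metis disjoint_mono)
  qed
  with fe(2) show ?thesis by blast
qed

text \<open>
Either every nonzero positive vector dominates an atom, and atoms can be chosen one after the other
because finitely many never exhaust the space, or some vector dominates none and can be split forever.
\<close>

lemma exists_disjoint_sequence:
  assumes inf_dim: "\<not> (\<exists>B :: 'a::banach_lattice set. finite B \<and> span B = UNIV)"
  shows "\<exists>e :: nat \<Rightarrow> 'a. (\<forall>i. 0 \<le> e i \<and> e i \<noteq> 0) \<and> (\<forall>i j. i \<noteq> j \<longrightarrow> inf (e i) (e j) = 0)"
proof -
  have "\<exists>e :: nat \<Rightarrow> 'a. \<forall>j. 0 \<le> e j \<and> e j \<noteq> 0 \<and> (\<forall>i<j. inf (e i) (e j) = 0)"
  proof (cases "\<forall>x::'a. 0 \<le> x \<longrightarrow> x \<noteq> 0 \<longrightarrow> (\<exists>a\<le>x. atom a)")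
    case True
    let ?P = "\<lambda>(f :: nat \<Rightarrow> 'a) j a. atom a \<and> (\<forall>i<j. inf (f i) a = 0)"
    have "\<exists>f. \<forall>j. ?P f j (f j)"
    proof (rule dependent_wellorder_choice)
      fix j and f :: "nat \<Rightarrow> 'a"
      assume "\<And>i. i < j \<Longrightarrow> ?P f i (f i)"
      then have "\<And>a. a \<in> f ` {..<j} \<Longrightarrow> atom a" by blast
      then obtain x where x: "0 \<le> x" "x \<noteq> 0" "\<And>a. a \<in> f ` {..<j} \<Longrightarrow> inf x a = 0"
        using exists_disjoint_from_atoms[OF inf_dim, of "f ` {..<j}"]
        by (metis finite_imageI finite_lessThan)
      then obtain a where a: "a \<le> x" "atom a" using True by blast
      have "inf (f i) a = 0" if "i < j" for i
      proof (rule disjoint_mono)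
        show "inf (f i) x = 0" using x(3)[of "f i"] that by (simp add: inf_commute)
      qed (use a in \<open>auto simp: atom_def\<close>)
      with a show "\<exists>a. ?P f j a" by blast
    qed auto
    then obtain f where "\<forall>j. ?P f j (f j)" by blast
    then show ?thesis by (intro exI[of _ f]) (simp add: atom_def)
  next
    case False
    then obtain x :: 'a where "0 \<le> x" "x \<noteq> 0" "\<And>a. a \<le> x \<Longrightarrow> \<not> atom a" by blast
    then show ?thesis by (rule disjoint_sequence_below_atomless)
  qed
  then obtain e :: "nat \<Rightarrow> 'a"
    where e: "\<forall>j. 0 \<le> e j \<and> e j \<noteq> 0 \<and> (\<forall>i<j. inf (e i) (e j) = 0)" by blast
  then have "inf (e i) (e j) = 0" if "i \<noteq> j" for i j
    using that by (metis inf_commute linorder_neq_iff)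
  with e show ?thesis by blast
qed

section \<open>Cesaro means and coordinatewise convergence\<close>

lemma tendsto_cesaro:
  fixes d :: "nat \<Rightarrow> 'a::real_normed_vector"
  assumes "d \<longlonglongrightarrow> l"
  shows "cesaro d \<longlonglongrightarrow> l"
proof (rule LIMSEQ_I)
  fix r :: real assume r: "r > 0"
  then obtain N where N: "\<And>j. j \<ge> N \<Longrightarrow> norm (d j - l) < r / 2"
    using LIMSEQ_D[OF assms, of "r / 2"] by auto
  define S where "S = (\<Sum>j<N. norm (d j - l))"
  obtain M :: nat where M: "S < real M * (r / 2)" using r reals_Archimedean3[of "r / 2"] by auto
  show "\<exists>n0. \<forall>n\<ge>n0. norm (cesaro d n - l) < r"
  proof (intro exI[of _ M] allI impI)
    fix n assume "M \<le> n"
    \<comment> \<open>The sum is split at \<open>N\<close>: the head is at most the constant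
      \<open>S\<close>, which \<open>M\<close> makes smaller than
      \<open>real (Suc n) * (r / 2)\<close>, and each later term is below
      \<open>r / 2\<close>.\<close>
    have "(\<Sum>j\<le>n. norm (d j - l)) \<le> (\<Sum>j\<le>n. (if j < N then norm (d j - l) else 0) + r / 2)"
      using N r by (intro sum_mono) (auto simp: not_less less_imp_le)
    also have "\<dots> = (\<Sum>j\<in>{..n} \<inter> {j. j < N}. norm (d j - l)) + real (Suc n) * (r / 2)"
      by (simp add: sum.distrib sum.inter_restrict)
    also have "(\<Sum>j\<in>{..n} \<inter> {j. j < N}. norm (d j - l)) \<le> S"
      unfolding S_def by (intro sum_mono2) auto
    also have "S < real (Suc n) * (r / 2)"
    proof -
      have "real M * (r / 2) \<le> real (Suc n) * (r / 2)"
        using \<open>M \<le> n\<close> r by (intro mult_right_mono) auto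
      with M show ?thesis by linarith
    qed
    finally have *: "(\<Sum>j\<le>n. norm (d j - l)) < real (Suc n) * r" by (simp add: field_simps)
    have "cesaro d n - l = (1 / real (Suc n)) *\<^sub>R (\<Sum>j\<le>n. d j - l)"
      by (simp add: cesaro_def sum_subtractf scaleR_diff_right sum_constant_scaleR)
    then have "norm (cesaro d n - l) \<le> (1 / real (Suc n)) * (\<Sum>j\<le>n. norm (d j - l))"
      by (simp add: norm_sum divide_right_mono)
    also have "\<dots> < r" using * by (simp add: pos_divide_less_eq mult.commute)
    finally show "norm (cesaro d n - l) < r" .
  qed
qed

text \<open>Tychonoff's theorem replaces an explicit diagonal argument: a countable product of
  compact intervals is compact and first countable, hence sequentially compact.\<close>

lemma bounded_coordinates_convergent_subsequence:
  fixes c :: "nat \<Rightarrow> nat \<Rightarrow> real"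
  assumes "\<And>j i. c j i \<in> {a..b}"
  obtains k where "strict_mono k" "\<And>i. convergent (\<lambda>j. c (k j) i)"
proof -
  have "compactin (product_topology (\<lambda>_. euclidean) UNIV) (PiE UNIV (\<lambda>_::nat. {a..b}))"
    by (simp add: compactin_PiE)
  then have "compact (PiE UNIV (\<lambda>_::nat. {a..b}))"
    by (simp add: euclidean_product_topology)
  then have "seq_compact (PiE UNIV (\<lambda>_::nat. {a..b}))" by (rule compact_imp_seq_compact)
  moreover have "c j \<in> PiE UNIV (\<lambda>_. {a..b})" for j using assms by auto
  ultimately obtain l k where k: "strict_mono k" "(c \<circ> k) \<longlonglongrightarrow> l"
    unfolding seq_compact_def by metis
  have "(\<lambda>j. (c \<circ> k) j i) \<longlonglongrightarrow> l i" for i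
  proof (rule isCont_tendsto_compose[OF _ k(2)])
    have "continuous_on UNIV (\<lambda>f :: nat \<Rightarrow> real. f i)" by (rule continuous_on_product_coordinates)
    then show "isCont (\<lambda>f. f i) l"
      unfolding continuous_on_eq_continuous_at[OF open_UNIV] by (rule bspec) (rule UNIV_I)
  qed
  with k that show thesis unfolding convergent_def by auto
qed

section \<open>Finite combinations of a disjoint sequence\<close>

text \<open>Summing over the support keeps the sum finite for the intended coefficients; for
  infinite support the value is \<open>0\<close> by convention.\<close>

definition comb :: "(nat \<Rightarrow> 'a) \<Rightarrow> (nat \<Rightarrow> real) \<Rightarrow> 'a::real_vector" where
  "comb e c = (\<Sum>k | c k \<noteq> 0. c k *\<^sub>R e k)"

definition unit_coeffs :: "(nat \<Rightarrow> real) set" where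
  "unit_coeffs = {c. finite {k. c k \<noteq> 0} \<and> (\<forall>k. 0 \<le> c k \<and> c k \<le> 1)}"

lemma comb_eq_sum:
  assumes "finite A" "\<And>k. c k \<noteq> 0 \<Longrightarrow> k \<in> A"
  shows "comb e c = (\<Sum>k\<in>A. c k *\<^sub>R e k)"
  unfolding comb_def
proof (rule sum.mono_neutral_left)
  show "{k. c k \<noteq> 0} \<subseteq> A" using assms(2) by blast
qed (use assms(1) in simp_all)

lemma cesaro_unit_coeffs:
  assumes "\<And>j. c j \<in> unit_coeffs"
  shows "(\<lambda>k. cesaro (\<lambda>j. c j k) m) \<in> unit_coeffs"
proof -
  have "{k. cesaro (\<lambda>j. c j k) m \<noteq> 0} \<subseteq> (\<Union>j\<le>m. {k. c j k \<noteq> 0})"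
    by (force simp: cesaro_def intro: sum.neutral)
  moreover have "finite (\<Union>j\<le>m. {k. c j k \<noteq> 0})"
    using assms by (simp add: unit_coeffs_def)
  moreover have "0 \<le> cesaro (\<lambda>j. c j k) m" for k
    using assms by (simp add: cesaro_def unit_coeffs_def sum_nonneg)
  moreover have "cesaro (\<lambda>j. c j k) m \<le> 1" for k
  proof -
    have "(\<Sum>j\<le>m. c j k) \<le> (\<Sum>j\<le>m. 1)" using assms by (intro sum_mono) (simp add: unit_coeffs_def)
    then show ?thesis by (simp add: cesaro_def)
  qed
  ultimately show ?thesis unfolding unit_coeffs_def using finite_subset by blast
qed

text \<open>Moves questions about means of vectors to means of real coefficients, after all supports
  are enlarged to a common finite set.\<close>

lemma cesaro_comb:
  fixes e :: "nat \<Rightarrow> 'a::real_vector"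
  assumes "\<And>j. c j \<in> unit_coeffs"
  shows "cesaro (\<lambda>j. comb e (c j)) m = comb e (\<lambda>k. cesaro (\<lambda>j. c j k) m)"
proof -
  define A where "A = (\<Union>j\<le>m. {k. c j k \<noteq> 0})"
  have A: "finite A" using assms by (simp add: A_def unit_coeffs_def)
  have "comb e (c j) = (\<Sum>k\<in>A. c j k *\<^sub>R e k)" if "j \<le> m" for j
    using that by (intro comb_eq_sum A) (auto simp: A_def)
  then have "(\<Sum>j\<le>m. comb e (c j)) = (\<Sum>j\<le>m. \<Sum>k\<in>A. c j k *\<^sub>R e k)" by simp
  also have "\<dots> = (\<Sum>k\<in>A. (\<Sum>j\<le>m. c j k) *\<^sub>R e k)"
    by (subst sum.swap) (simp add: scaleR_left.sum)
  finally have "cesaro (\<lambda>j. comb e (c j)) m = (\<Sum>k\<in>A. cesaro (\<lambda>j. c j k) m *\<^sub>R e k)"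
    by (simp add: cesaro_def scaleR_right.sum)
  also have "\<dots> = comb e (\<lambda>k. cesaro (\<lambda>j. c j k) m)"
    by (rule comb_eq_sum[symmetric, OF A]) (auto simp: A_def cesaro_def intro: sum.neutral)
  finally show ?thesis .
qed

lemma abs_comb_diff_le:
  fixes e :: "nat \<Rightarrow> 'a::banach_lattice"
  assumes e: "\<And>k. 0 \<le> e k" and cd: "c \<in> unit_coeffs" "d \<in> unit_coeffs"
  obtains A where "finite A" "i \<in> A" "\<bar>comb e c - comb e d\<bar> \<le> (\<Sum>k\<in>A. \<bar>c k - d k\<bar> *\<^sub>R e k)"
proof
  \<comment> \<open>The given \<open>i\<close> is added by force: both coefficients may vanish
    there, yet the term at \<open>i\<close> has to be available for splitting off.\<close>
  define A where "A = insert i ({k. c k \<noteq> 0} \<union> {k. d k \<noteq> 0})"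
  show A: "finite A" using cd by (simp add: A_def unit_coeffs_def)
  show "i \<in> A" by (simp add: A_def)
  have "comb e c - comb e d = (\<Sum>k\<in>A. c k *\<^sub>R e k) - (\<Sum>k\<in>A. d k *\<^sub>R e k)"
    by (intro arg_cong2[of _ _ _ _ minus] comb_eq_sum A) (auto simp: A_def)
  also have "\<dots> = (\<Sum>k\<in>A. (c k - d k) *\<^sub>R e k)"
    by (simp add: sum_subtractf scaleR_diff_left)
  finally have "\<bar>comb e c - comb e d\<bar> \<le> (\<Sum>k\<in>A. \<bar>(c k - d k) *\<^sub>R e k\<bar>)" by (simp only: sum_abs)
  also have "\<dots> \<le> (\<Sum>k\<in>A. \<bar>c k - d k\<bar> *\<^sub>R e k)"
  proof (intro sum_mono abs_leI)
    fix k
    show "(c k - d k) *\<^sub>R e k \<le> \<bar>c k - d k\<bar> *\<^sub>R e k" using e by (intro scaleR_right_mono) auto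
    have "(- (c k - d k)) *\<^sub>R e k \<le> \<bar>c k - d k\<bar> *\<^sub>R e k" using e by (intro scaleR_right_mono) auto
    then show "- ((c k - d k) *\<^sub>R e k) \<le> \<bar>c k - d k\<bar> *\<^sub>R e k" by (simp only: scaleR_minus_left)
  qed
  finally show "\<bar>comb e c - comb e d\<bar> \<le> (\<Sum>k\<in>A. \<bar>c k - d k\<bar> *\<^sub>R e k)" .
qed

text \<open>In the bound for a difference, the term at \<open>i\<close> is small by convergence of
  that single coordinate, and the other terms are disjoint from \<open>e i\<close>. A vector
  disjoint from every \<open>e k\<close> is disjoint from the whole bound.\<close>

lemma uo_cauchy_comb:
  fixes e :: "nat \<Rightarrow> 'a::banach_lattice"
  assumes e: "\<And>k. 0 \<le> e k" and disj: "\<And>i j. i \<noteq> j \<Longrightarrow> inf (e i) (e j) = 0"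
    and c: "\<And>n. c n \<in> unit_coeffs" and conv: "\<And>i. convergent (\<lambda>n. c n i)"
  shows "uo_cauchy (\<lambda>n. comb e (c n))"
proof (rule uo_cauchy_criterion[where S = "range e"])
  fix a and \<epsilon> :: real assume "a \<in> range e" and eps: "\<epsilon> > 0"
  then obtain i where i: "a = e i" by blast
  have "Cauchy (\<lambda>n. c n i)" using conv by (rule convergent_Cauchy)
  then obtain n0 where n0: "\<And>n m. n \<ge> n0 \<Longrightarrow> m \<ge> n0 \<Longrightarrow> \<bar>c n i - c m i\<bar> < \<epsilon>"
    using CauchyD[OF _ eps] by (metis real_norm_def)
  have "\<exists>h. inf a h = 0 \<and> \<bar>comb e (c n) - comb e (c m)\<bar> \<le> \<epsilon> *\<^sub>R a + h"
    if nm: "n \<ge> n0" "m \<ge> n0" for n m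
  proof -
    obtain A where A: "finite A" "i \<in> A"
        "\<bar>comb e (c n) - comb e (c m)\<bar> \<le> (\<Sum>k\<in>A. \<bar>c n k - c m k\<bar> *\<^sub>R e k)"
      by (rule abs_comb_diff_le[OF e c c])
    define h where "h = (\<Sum>k\<in>A - {i}. \<bar>c n k - c m k\<bar> *\<^sub>R e k)"
    have "inf a h = 0"
      unfolding h_def i
    proof (rule disjoint_sum)
      show "inf (e i) (\<bar>c n k - c m k\<bar> *\<^sub>R e k) = 0" if "k \<in> A - {i}" for k
        using that disj[of i k] by (intro disjoint_scaleR) auto
    qed (rule e)
    note A(3)
    also have "(\<Sum>k\<in>A. \<bar>c n k - c m k\<bar> *\<^sub>R e k) = \<bar>c n i - c m i\<bar> *\<^sub>R a + h"
      unfolding h_def i using A(1,2) by (rule sum.remove)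
    also have "\<dots> \<le> \<epsilon> *\<^sub>R a + h"
      using n0[OF nm] e i by (intro add_right_mono scaleR_right_mono) auto
    finally show ?thesis using \<open>inf a h = 0\<close> by blast
  qed
  then show "\<exists>n0. \<forall>n\<ge>n0. \<forall>m\<ge>n0. \<exists>h. inf a h = 0 \<and>
      \<bar>comb e (c n) - comb e (c m)\<bar> \<le> \<epsilon> *\<^sub>R a + h" by blast
next
  fix z :: 'a and n m assume z: "0 \<le> z" and orth: "\<And>a. a \<in> range e \<Longrightarrow> inf z a = 0"
  obtain A where A: "finite A"
      "\<bar>comb e (c n) - comb e (c m)\<bar> \<le> (\<Sum>k\<in>A. \<bar>c n k - c m k\<bar> *\<^sub>R e k)"
    by (rule abs_comb_diff_le[OF e c c])
  have "inf z (\<Sum>k\<in>A. \<bar>c n k - c m k\<bar> *\<^sub>R e k) = 0"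
  proof (rule disjoint_sum[OF _ z])
    show "inf z (\<bar>c n k - c m k\<bar> *\<^sub>R e k) = 0" for k
      by (rule disjoint_scaleR[OF orth]) auto
  qed
  then show "inf z \<bar>comb e (c n) - comb e (c m)\<bar> = 0"
    by (rule disjoint_mono[OF _ abs_ge_zero A(2)])
qed (use e in auto)

section \<open>Properties of the set C, and the theorem\<close>

lemma uo_limit_ge:
  fixes g :: "nat \<Rightarrow> 'a::banach_lattice"
  assumes lim: "uo_convergent_to g l" and ge: "\<And>m. m \<ge> m0 \<Longrightarrow> a \<le> g m"
  shows "a \<le> l"
proof -
  \<comment> \<open>This positive part itself is the truncation vector: from \<open>m0\<close> on it
    lies below \<open>\<bar>g n - l\<bar>\<close>, so truncating there returns \<open>p\<close>, and
    \<open>p\<close> becomes a lower bound of the dominating sequence.\<close>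
  define p where "p = sup (a - l) 0"
  have "0 \<le> p" by (simp add: p_def)
  with lim obtain y where y: "decseq y" "isGlb UNIV (range y) 0"
      and bound: "\<And>n. \<bar>inf \<bar>g n - l\<bar> p - 0\<bar> \<le> y n"
    unfolding uo_convergent_to_def order_convergent_to_def seq_decreasing_to_zero_def by blast
  have late: "p \<le> y n" if "n \<ge> m0" for n
  proof -
    have "a - l \<le> g n - l" using ge[OF that] by simp
    also have "\<dots> \<le> \<bar>g n - l\<bar>" by (rule abs_ge_self)
    finally have "p \<le> \<bar>g n - l\<bar>" by (simp add: p_def)
    then have "inf \<bar>g n - l\<bar> p = p" by (rule inf_absorb2)
    with bound[of n] \<open>0 \<le> p\<close> show ?thesis by simp
  qed
  have "p \<le> y n" for n
  proof -
    have "p \<le> y (max n m0)" by (rule late) simp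
    also have "\<dots> \<le> y n" using y(1) by (simp add: decseqD)
    finally show ?thesis .
  qed
  then have "p \<le> 0"
    using y(2) unfolding isGlb_def greatestP_def isLb_def setge_def setle_def by blast
  then show ?thesis by (simp add: p_def)
qed

lemma convex_comb_image: "convex (comb e ` unit_coeffs)"
proof (rule convexI)
  fix x y and u v :: real
  assume "x \<in> comb e ` unit_coeffs" "y \<in> comb e ` unit_coeffs" and uv: "0 \<le> u" "0 \<le> v" "u + v = 1"
  then obtain c d where c: "c \<in> unit_coeffs" "x = comb e c" and d: "d \<in> unit_coeffs" "y = comb e d"
    by blast
  define f where "f = (\<lambda>k. u * c k + v * d k)"
  define A where "A = {k. c k \<noteq> 0} \<union> {k. d k \<noteq> 0}"
  have A: "finite A" using c d by (simp add: A_def unit_coeffs_def)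
  have supp: "f k \<noteq> 0 \<Longrightarrow> k \<in> A" for k by (auto simp: f_def A_def)
  have "comb e c = (\<Sum>k\<in>A. c k *\<^sub>R e k)" "comb e d = (\<Sum>k\<in>A. d k *\<^sub>R e k)"
    by (rule comb_eq_sum[OF A]; simp add: A_def)+
  moreover have "comb e f = (\<Sum>k\<in>A. f k *\<^sub>R e k)"
    by (rule comb_eq_sum[OF A supp])
  ultimately have "u *\<^sub>R x + v *\<^sub>R y = comb e f"
    by (simp add: c d f_def scaleR_right.sum scaleR_add_left sum.distrib)
  moreover have "f \<in> unit_coeffs"
  proof -
    have "finite {k. f k \<noteq> 0}" by (rule finite_subset[OF _ A]) (use supp in blast)
    moreover have "0 \<le> f k" for k using c d uv by (simp add: f_def unit_coeffs_def)
    moreover have "f k \<le> 1" for k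
      using c d uv by (auto simp: f_def unit_coeffs_def intro!: convex_bound_le)
    ultimately show ?thesis by (simp add: unit_coeffs_def)
  qed
  ultimately show "u *\<^sub>R x + v *\<^sub>R y \<in> comb e ` unit_coeffs" by blast
qed

lemma uo_pre_komlos_comb_image:
  fixes e :: "nat \<Rightarrow> 'a::banach_lattice"
  assumes e: "\<And>k. 0 \<le> e k" and disj: "\<And>i j. i \<noteq> j \<Longrightarrow> inf (e i) (e j) = 0"
  shows "uo_pre_komlos_set (comb e ` unit_coeffs)"
  unfolding uo_pre_komlos_set_def
proof (intro allI impI)
  fix x :: "nat \<Rightarrow> 'a" assume "range x \<subseteq> comb e ` unit_coeffs"
  then have "\<forall>j. \<exists>c. c \<in> unit_coeffs \<and> x j = comb e c" by blast
  then obtain c where c: "\<And>j. c j \<in> unit_coeffs" "\<And>j. x j = comb e (c j)" by metis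
  have "c j i \<in> {0..1}" for j i using c(1)[of j] by (simp add: unit_coeffs_def)
  \<comment> \<open>The choice of \<open>k\<close> precedes that of \<open>s\<close>: limits of
    coordinates pass to every further subsequence and then to its Cesaro means.\<close>
  then obtain k where k: "strict_mono k" "\<And>i. convergent (\<lambda>j. c (k j) i)"
    using bounded_coordinates_convergent_subsequence by blast
  have "uo_cauchy (cesaro (x \<circ> k \<circ> s))" if s: "strict_mono s" for s :: "nat \<Rightarrow> nat"
  proof -
    define d where "d = (\<lambda>m i. cesaro (\<lambda>j. c (k (s j)) i) m)"
    have "cesaro (x \<circ> k \<circ> s) = (\<lambda>m. comb e (d m))"
      by (simp add: fun_eq_iff comp_def c(2) d_def cesaro_comb c(1))
    moreover have "uo_cauchy (\<lambda>m. comb e (d m))"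
    proof (rule uo_cauchy_comb[OF e disj])
      show "d m \<in> unit_coeffs" for m unfolding d_def by (rule cesaro_unit_coeffs) (rule c(1))
      show "convergent (\<lambda>m. d m i)" for i
      proof -
        obtain l where "(\<lambda>j. c (k j) i) \<longlonglongrightarrow> l" using k(2) convergent_def by blast
        from LIMSEQ_subseq_LIMSEQ[OF this s] have "(\<lambda>j. c (k (s j)) i) \<longlonglongrightarrow> l" by (simp add: comp_def)
        then have "(\<lambda>m. d m i) \<longlonglongrightarrow> l" unfolding d_def by (rule tendsto_cesaro)
        then show ?thesis by (rule convergentI)
      qed
    qed auto
    ultimately show ?thesis by simp
  qed
  with k(1) show "\<exists>k::nat \<Rightarrow> nat. strict_mono k \<and>
      (\<forall>s::nat \<Rightarrow> nat. strict_mono s \<longrightarrow> uo_cauchy (cesaro (x \<circ> k \<circ> s)))"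
    by blast
qed

lemma not_uo_komlos_comb_image:
  fixes e :: "nat \<Rightarrow> 'a::banach_lattice"
  assumes e: "\<And>k. 0 \<le> e k" and norm_e: "\<And>k. norm (e k) = real k"
  shows "\<not> uo_komlos_set (comb e ` unit_coeffs)"
proof
  assume komlos: "uo_komlos_set (comb e ` unit_coeffs)"
  \<comment> \<open>The form with coefficients gives membership in C; the equal partial sum serves
    the estimates.\<close>
  define x where "x = (\<lambda>n. comb e (\<lambda>k. if k < n then 1 else 0))"
  have x: "x n = (\<Sum>k<n. e k)" for n
  proof -
    have "x n = (\<Sum>k<n. (if k < n then 1 else 0) *\<^sub>R e k)"
      unfolding x_def by (rule comb_eq_sum) (auto split: if_splits)
    then show ?thesis by simp
  qed
  have "range x \<subseteq> comb e ` unit_coeffs"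
    by (auto simp: x_def unit_coeffs_def)
  then obtain k :: "nat \<Rightarrow> nat" and l where k: "strict_mono k"
      and lim: "\<And>s :: nat \<Rightarrow> nat. strict_mono s \<Longrightarrow> uo_convergent_to (cesaro (x \<circ> k \<circ> s)) l"
    using komlos unfolding uo_komlos_set_def by blast
  have half: "(1 / 2) *\<^sub>R e i \<le> l" for i
  proof (rule uo_limit_ge[OF lim[OF strict_mono_id]])
    \<comment> \<open>Since \<open>k j \<ge> j\<close>, the \<open>m - i\<close> terms with
      \<open>i < j \<le> m\<close> all dominate \<open>e i\<close>. Among \<open>m + 1\<close> terms
      they make up at least half exactly when \<open>m \<ge> 2 * i + 1\<close>.\<close>
    fix m assume m: "2 * i + 1 \<le> m"
    have xi: "e i \<le> x (k j)" if "j \<in> {i<..m}" for j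
    proof -
      have "i < k j" using that strict_mono_imp_increasing[OF k, of j] by simp
      then have "(\<Sum>k\<in>{i}. e k) \<le> (\<Sum>k<k j. e k)" using e by (intro sum_mono2) auto
      then show ?thesis by (simp add: x)
    qed
    have "real (m - i) *\<^sub>R e i = (\<Sum>j\<in>{i<..m}. e i)" by (simp add: sum_constant_scaleR)
    also have "\<dots> \<le> (\<Sum>j\<in>{i<..m}. x (k j))" by (rule sum_mono) (rule xi)
    also have "\<dots> \<le> (\<Sum>j\<le>m. x (k j))" using e by (intro sum_mono2) (auto simp: x sum_nonneg)
    finally have "(1 / real (Suc m)) *\<^sub>R (real (m - i) *\<^sub>R e i) \<le> cesaro (x \<circ> k \<circ> id) m"
      unfolding cesaro_def comp_def id_def by (intro scaleR_left_mono) simp_all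
    moreover have "(1 / 2) *\<^sub>R e i \<le> (1 / real (Suc m)) *\<^sub>R (real (m - i) *\<^sub>R e i)"
      unfolding scaleR_scaleR using m e by (intro scaleR_right_mono) (auto simp: field_simps of_nat_diff)
    ultimately show "(1 / 2) *\<^sub>R e i \<le> cesaro (x \<circ> k \<circ> id) m" by (rule order_trans[rotated])
  qed
  have "real i \<le> 2 * norm l" for i
  proof -
    have "0 \<le> (1 / 2) *\<^sub>R e i" using e by (simp add: scaleR_nonneg_nonneg)
    then have "\<bar>(1 / 2) *\<^sub>R e i\<bar> \<le> \<bar>l\<bar>" using half[of i] abs_ge_self[of l] by (simp add: abs_of_nonneg)
    then have "norm ((1 / 2) *\<^sub>R e i) \<le> norm l" by (rule norm_abs_mono)
    then show ?thesis by (simp add: norm_e)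
  qed
  then show False by (meson not_le reals_Archimedean2)
qed

theorem theorem6:
  assumes "\<not> (\<exists>B :: 'a::banach_lattice set. finite B \<and> span B = UNIV)"
  shows "\<exists>C :: 'a set. C \<subseteq> {0..} \<and> \<not> bounded C \<and> convex C \<and>
           uo_pre_komlos_set C \<and> \<not> uo_komlos_set C"
proof -
  obtain a :: "nat \<Rightarrow> 'a" where
    "(\<forall>i. 0 \<le> a i \<and> a i \<noteq> 0) \<and> (\<forall>i j. i \<noteq> j \<longrightarrow> inf (a i) (a j) = 0)"
    using exists_disjoint_sequence[OF assms] by (rule exE)
  then have a: "\<And>i. 0 \<le> a i" "\<And>i. a i \<noteq> 0" "\<And>i j. i \<noteq> j \<Longrightarrow> inf (a i) (a j) = 0"
    by auto
  \<comment> \<open>The norms \<open>real i\<close> make C unbounded and rule out a limit dominating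
    every \<open>(1 / 2) *\<^sub>R e i\<close>. The term \<open>e 0\<close> is the zero
    vector.\<close>
  define e where "e = (\<lambda>i. (real i / norm (a i)) *\<^sub>R a i)"
  have e: "0 \<le> e i" for i using a(1) by (simp add: e_def scaleR_nonneg_nonneg)
  have norm_e: "norm (e i) = real i" for i using a(2) by (simp add: e_def)
  have disj: "inf (e i) (e j) = 0" if "i \<noteq> j" for i j
  proof -
    have "inf (a i) (e j) = 0" unfolding e_def using a(3)[OF that] by (rule disjoint_scaleR) simp
    then have "inf (e j) (a i) = 0" by (simp only: inf_commute)
    then have "inf (e j) (e i) = 0" unfolding e_def[THEN fun_cong, of i] by (rule disjoint_scaleR) simp
    then show ?thesis by (simp only: inf_commute)
  qed
  let ?C = "comb e ` unit_coeffs"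
  have "?C \<subseteq> {0..}" using e
    by (auto simp: comb_def unit_coeffs_def intro!: sum_nonneg scaleR_nonneg_nonneg)
  moreover have "\<not> bounded ?C"
  proof
    assume "bounded ?C"
    then obtain b where b: "\<And>x. x \<in> ?C \<Longrightarrow> norm x \<le> b" unfolding bounded_iff by blast
    have "real i \<le> b" for i
    proof -
      let ?c = "\<lambda>k. if k = i then 1 else 0 :: real"
      have "comb e ?c = (\<Sum>k\<in>{i}. ?c k *\<^sub>R e k)" by (rule comb_eq_sum) (auto split: if_splits)
      then have "comb e ?c = e i" by simp
      moreover have "?c \<in> unit_coeffs" by (simp add: unit_coeffs_def)
      ultimately show ?thesis using b norm_e by (metis imageI)
    qed
    then show False by (meson not_le reals_Archimedean2)
  qed
  moreover have "convex ?C" by (rule convex_comb_image)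
  moreover have "uo_pre_komlos_set ?C" using e disj by (rule uo_pre_komlos_comb_image)
  moreover have "\<not> uo_komlos_set ?C" using e norm_e by (rule not_uo_komlos_comb_image)
  ultimately show ?thesis by (intro exI[of _ ?C] conjI)
qed

end
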